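(* Let $\gamma_0=\frac{\sqrt5-1}{2}$. There is an absolute constant $C>0$ such that the following holds. Let $\varepsilon>0$, let $N$ be a positive integer and let $k=N^{\gamma_0-\varepsilon}$. Then for every positive integer $m\leq 3Nk$ we have $$\tau(m;2N,2N+2k)\leq C\varepsilon^{-1}.$$
   Context: For a positive integer $m$ and reals $a\leq b$, $\tau(m;a,b)=\#\{d\in\mathbb{N}: d\mid m,\ a\leq d\leq b\}$ denotes the number of divisors of $m$ in the interval $[a,b]$.
   Formalization: For N = 1 the formal statement additionally assumes ε ≤ γ₀; without this the claim fails, since N = 1 gives k = 1 for every ε and m = 2 has τ(2;2,4) = 1 > C/ε once ε > C. All ε > 0 are kept for N ≥ 2. *)

theory Defs
  imports Complex_Main
begin

definition tau :: "nat \<Rightarrow> real \<Rightarrow> real \<Rightarrow> nat" where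
  "tau m a b = card {d::nat. d dvd m \<and> a \<le> real d \<and> real d \<le> b}"

definition gamma0 :: real where
  "gamma0 = (sqrt 5 - 1) / 2"

end

(* Let S be a set of t divisors of m. For every h, the number (\<Prod>d\<in>S. d)^(2h) divides
   m^(h(h+1)) * (\<Prod>x\<noteq>y in S. gcd x y); this is checked prime by prime. If the elements of S are
   at least 2N and lie in an interval of length k/3, then gcd x y \<le> \<bar>x - y\<bar> \<le> k/3, so
   (2N)^(2ht) \<le> m^(h(h+1)) * (k/3)^(t(t-1)). Comparing the exponents of N for h = \<lfloor>gamma0 t\<rfloor>, whose
   quadratic parts cancel at epsilon = 0 because gamma0 (1 + gamma0) = 1, gives t < 2/epsilon.
   Seven intervals of length k/3 cover [2N, 2N + 2k]; working with k/3 instead of 2k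
   absorbs the constant 3 in m \<le> 3Nk. *)
theory Submission
  imports Defs "HOL-Computational_Algebra.Primes"
begin

text \<open>Meant for \<open>a\<close> the exponents of a fixed prime in the divisors in
  \<open>S\<close>, and \<open>M\<close> its exponent in \<open>m\<close>. Induction on
  \<open>h\<close> by deleting a largest entry \<open>z\<close>: every minimum with
  \<open>a z\<close> is the other entry, so the pair sum drops by exactly twice the sum over the
  rest. The remaining term \<open>2 * (h + 1) * a z\<close> is covered by the increase
  \<open>2 * (h + 1) * M\<close> of \<open>M * (h * (h + 1))\<close>.\<close>

lemma sum_le_sum_min_pairs:
  fixes a :: "'a \<Rightarrow> nat"
  assumes "finite S" "\<And>x. x \<in> S \<Longrightarrow> a x \<le> M"
  shows "2 * h * (\<Sum>x\<in>S. a x) \<le> M * (h * (h + 1)) + (\<Sum>x\<in>S. \<Sum>y\<in>S - {x}. min (a x) (a y))"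
  using assms
proof (induction h arbitrary: S)
  case 0
  then show ?case by simp
next
  case (Suc h)
  show ?case
  proof (cases "S = {}")
    case False
    then have "Max (a ` S) \<in> a ` S"
      using Suc.prems(1) by simp
    then obtain z where "z \<in> S" "Max (a ` S) = a z"
      by blast
    then have z: "z \<in> S" "\<And>x. x \<in> S \<Longrightarrow> a x \<le> a z"
      using Suc.prems(1) Max_ge[of "a ` S"] by auto
    define T where "T = S - {z}"
    have T: "S = insert z T" "z \<notin> T" "finite T"
      using z Suc.prems(1) by (auto simp: T_def)
    have IH: "2 * h * (\<Sum>x\<in>T. a x) \<le>
        M * (h * (h + 1)) + (\<Sum>x\<in>T. \<Sum>y\<in>T - {x}. min (a x) (a y))"
      using T Suc.prems by (intro Suc.IH) auto
    have "(\<Sum>y\<in>S - {x}. min (a x) (a y)) = a x + (\<Sum>y\<in>T - {x}. min (a x) (a y))"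
      if "x \<in> T" for x
    proof -
      have "S - {x} = insert z (T - {x})" using T that by auto
      then show ?thesis using T z(2)[of x] that by simp
    qed
    moreover have "(\<Sum>y\<in>S - {z}. min (a z) (a y)) = (\<Sum>y\<in>T. a y)"
      using z(2) T by (intro sum.cong) auto
    ultimately have "(\<Sum>x\<in>S. \<Sum>y\<in>S - {x}. min (a x) (a y)) =
        2 * (\<Sum>y\<in>T. a y) + (\<Sum>x\<in>T. \<Sum>y\<in>T - {x}. min (a x) (a y))"
      using T by (simp add: sum.distrib)
    moreover have "(h + 1) * a z \<le> (h + 1) * M"
      using Suc.prems(2) z(1) by (intro mult_left_mono) auto
    ultimately show ?thesis
      using IH T by (simp add: algebra_simps)
  qed simp
qed

text \<open>The exponent of a prime in a gcd is the minimum of the two exponents, so at each prime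
  this becomes \<open>sum_le_sum_min_pairs\<close>.\<close>

lemma prod_divisors_dvd:
  fixes m :: nat
  assumes "finite S" "m > 0" "\<And>d. d \<in> S \<Longrightarrow> d dvd m"
  shows "(\<Prod>d\<in>S. d) ^ (2 * h) dvd m ^ (h * (h + 1)) * (\<Prod>x\<in>S. \<Prod>y\<in>S - {x}. gcd x y)"
proof (rule multiplicity_le_imp_dvd)
  have pos: "d > 0" if "d \<in> S" for d
    using assms(2) assms(3)[OF that] by (auto intro: dvd_pos_nat)
  have "0 \<notin> S"
    using pos by auto
  have "(\<Prod>d\<in>S. d) > 0"
    using pos by (intro prod_pos) auto
  then show "(\<Prod>d\<in>S. d) ^ (2 * h) \<noteq> 0" by simp
  fix p :: nat assume p: "prime p"
  have P: "(\<Prod>x\<in>S. \<Prod>y\<in>S - {x}. gcd x y) \<noteq> 0"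
    using pos by (intro notI) (auto simp: assms(1))
  have "multiplicity p ((\<Prod>d\<in>S. d) ^ (2 * h)) = 2 * h * (\<Sum>d\<in>S. multiplicity p d)"
    using p \<open>0 \<notin> S\<close> \<open>(\<Prod>d\<in>S. d) > 0\<close> assms(1)
    by (subst prime_elem_multiplicity_power_distrib)
       (auto simp: prime_elem_multiplicity_prod_distrib image_iff)
  also have "\<dots> \<le> multiplicity p m * (h * (h + 1)) +
      (\<Sum>x\<in>S. \<Sum>y\<in>S - {x}. min (multiplicity p x) (multiplicity p y))"
    using assms by (intro sum_le_sum_min_pairs) (auto intro: dvd_imp_multiplicity_le)
  also have "(\<Sum>x\<in>S. \<Sum>y\<in>S - {x}. min (multiplicity p x) (multiplicity p y)) =
      (\<Sum>x\<in>S. \<Sum>y\<in>S - {x}. multiplicity p (gcd x y))"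
    using p pos by (intro sum.cong refl) (simp add: multiplicity_gcd)
  also have "\<dots> = (\<Sum>x\<in>S. multiplicity p (\<Prod>y\<in>S - {x}. gcd x y))"
    using p pos assms(1)
    by (intro sum.cong refl, subst prime_elem_multiplicity_prod_distrib) (auto simp: image_iff)
  also have "\<dots> = multiplicity p (\<Prod>x\<in>S. \<Prod>y\<in>S - {x}. gcd x y)"
    using p pos assms(1) by (subst prime_elem_multiplicity_prod_distrib) (auto simp: image_iff)
  also have "multiplicity p m * (h * (h + 1)) + multiplicity p (\<Prod>x\<in>S. \<Prod>y\<in>S - {x}. gcd x y) =
      multiplicity p (m ^ (h * (h + 1)) * (\<Prod>x\<in>S. \<Prod>y\<in>S - {x}. gcd x y))"
    using p P assms(2)
    by (simp add: prime_elem_multiplicity_mult_distrib prime_elem_multiplicity_power_distrib)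
  finally show "multiplicity p ((\<Prod>d\<in>S. d) ^ (2 * h)) \<le>
      multiplicity p (m ^ (h * (h + 1)) * (\<Prod>x\<in>S. \<Prod>y\<in>S - {x}. gcd x y))" .
qed

lemma gcd_le_dist_nat:
  fixes x y :: nat
  assumes "x \<noteq> y"
  shows "real (gcd x y) \<le> \<bar>real x - real y\<bar>"
proof -
  \<comment> \<open>Integers avoid the truncated subtraction of naturals.\<close>
  have "int (gcd x y) dvd int x - int y"
    by (intro dvd_diff) auto
  then have "int (gcd x y) \<le> \<bar>int x - int y\<bar>"
    using assms dvd_imp_le_int[of "int x - int y" "int (gcd x y)"] by simp
  then have "real_of_int (int (gcd x y)) \<le> real_of_int \<bar>int x - int y\<bar>"
    by (rule of_int_le_iff[THEN iffD2])
  then show ?thesis by simp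
qed

text \<open>The divisibility in \<open>prod_divisors_dvd\<close> turned into a size bound: each
  divisor is at least \<open>A\<close>, and each ordered pair of distinct divisors contributes a gcd
  of at most \<open>D\<close>.\<close>

lemma close_divisors_power_le:
  fixes A D :: real
  assumes "finite S" "m > 0" "A \<ge> 0"
    and "\<And>d. d \<in> S \<Longrightarrow> d dvd m \<and> A \<le> real d"
    and "\<And>x y. x \<in> S \<Longrightarrow> y \<in> S \<Longrightarrow> \<bar>real x - real y\<bar> \<le> D"
  shows "A ^ (2 * h * card S) \<le> real m ^ (h * (h + 1)) * D ^ (card S * (card S - 1))"
proof -
  have "(\<Prod>d\<in>S. d) ^ (2 * h) \<le> m ^ (h * (h + 1)) * (\<Prod>x\<in>S. \<Prod>y\<in>S - {x}. gcd x y)"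
    using assms by (intro dvd_imp_le prod_divisors_dvd) (auto intro!: Nat.gr0I)
  then have "(\<Prod>d\<in>S. real d) ^ (2 * h) \<le>
      real m ^ (h * (h + 1)) * (\<Prod>x\<in>S. \<Prod>y\<in>S - {x}. real (gcd x y))"
    by (simp flip: of_nat_prod of_nat_mult of_nat_power del: mult_Suc_right power_Suc)
  also have "(\<Prod>x\<in>S. \<Prod>y\<in>S - {x}. real (gcd x y)) \<le> (\<Prod>x\<in>S. \<Prod>y\<in>S - {x}. D)"
  proof (intro prod_mono conjI prod_nonneg)
    fix x y assume "x \<in> S" "y \<in> S - {x}"
    then show "real (gcd x y) \<le> D"
      using gcd_le_dist_nat[of x y] assms(5)[of x y] by auto
  qed auto
  also have "(\<Prod>x\<in>S. \<Prod>y\<in>S - {x}. D) = D ^ (card S * (card S - 1))"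
    using assms(1) by (simp add: mult.commute flip: power_mult)
  finally have "(\<Prod>d\<in>S. real d) ^ (2 * h) \<le> real m ^ (h * (h + 1)) * D ^ (card S * (card S - 1))"
    by (simp add: mult_left_mono)
  moreover have "A ^ card S \<le> (\<Prod>d\<in>S. real d)"
    using prod_mono[of S "\<lambda>_. A" real] assms(3,4) by simp
  then have "(A ^ card S) ^ (2 * h) \<le> (\<Prod>d\<in>S. real d) ^ (2 * h)"
    using assms(3) by (intro power_mono) auto
  ultimately show ?thesis
    by (simp add: mult.commute flip: power_mult)
qed

lemma gamma0_bounds: "1 / 2 < gamma0" "gamma0 < 1"
proof -
  have "2 < sqrt 5" "sqrt 5 < 3"
    by (simp_all add: real_less_rsqrt real_less_lsqrt)
  then show "1 / 2 < gamma0" "gamma0 < 1"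
    by (simp_all add: gamma0_def)
qed

lemma gamma0_square: "gamma0\<^sup>2 = 1 - gamma0"
  by (simp add: gamma0_def power2_eq_square field_simps)

text \<open>At \<beta> = \<open>gamma0\<close> the quadratic part of right side minus left side is
  the square \<open>(1 + gamma0) * (h - gamma0 * t)^2\<close>, which is bounded because
  \<open>h\<close> is within 1 of \<open>gamma0 * t\<close>. So the loss \<epsilon>(h^2 + t^2) has
  to be smaller than terms linear in \<open>t\<close>.\<close>

lemma exponent_bound:
  fixes \<epsilon> \<beta> :: real and h t :: nat
  assumes "\<beta> = gamma0 - \<epsilon>" "\<beta> > 0" "\<epsilon> > 0" "h + 1 \<le> t"
    and "\<bar>real h - gamma0 * real t\<bar> \<le> 1"
    and "2 * real h * real t < (1 + \<beta>) * real (h * (h + 1)) + \<beta> * real (t * (t - 1))"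
  shows "\<epsilon> * real t < 2"
proof -
  have t: "real (t * (t - 1)) = real t * (real t - 1)"
    using assms(4) by (simp add: of_nat_diff)
  have "(1 + gamma0) * (real h - gamma0 * real t)\<^sup>2 \<le> (1 + gamma0) * 1"
    using assms(5) gamma0_bounds by (intro mult_left_mono) (auto simp: abs_square_le_1)
  moreover have "(1 + gamma0) * (real h - gamma0 * real t)\<^sup>2 =
      (1 + gamma0) * (real h)\<^sup>2 - 2 * real h * real t + gamma0 * (real t)\<^sup>2"
  proof -
    have "(1 + gamma0) * gamma0 = 1"
      using gamma0_square by (simp add: power2_eq_square algebra_simps)
    moreover have "(1 + gamma0) * (real h - gamma0 * real t)\<^sup>2 =
        (1 + gamma0) * (real h)\<^sup>2 - 2 * ((1 + gamma0) * gamma0) * (real h * real t)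
          + ((1 + gamma0) * gamma0) * gamma0 * (real t)\<^sup>2"
      by (simp add: power2_eq_square algebra_simps)
    ultimately show ?thesis by simp
  qed
  ultimately have "(1 + gamma0) * (real h)\<^sup>2 - 2 * real h * real t + gamma0 * (real t)\<^sup>2 \<le> 1 + gamma0"
    by simp
  moreover have "\<beta> * (real h - real t) \<le> 0"
    using assms(2,4) by (intro mult_nonneg_nonpos) auto
  moreover have "0 \<le> \<epsilon> * (real h)\<^sup>2"
    using assms(3) by simp
  moreover have "2 * real h * real t < (1 + gamma0) * (real h)\<^sup>2 + gamma0 * (real t)\<^sup>2
      - \<epsilon> * (real h)\<^sup>2 - \<epsilon> * (real t)\<^sup>2 + real h + \<beta> * (real h - real t)"
    using assms(6) unfolding t assms(1) by (simp add: power2_eq_square algebra_simps)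
  moreover have "real h + 1 \<le> real t" "0 \<le> real h"
    using assms(4) by linarith+
  \<comment> \<open>The terms left over are at most \<open>1 + gamma0 + h\<close>, hence at most
    \<open>gamma0 + t\<close>, which is below \<open>2 * t\<close>.\<close>
  ultimately have "\<epsilon> * (real t)\<^sup>2 < 2 * real t"
    using gamma0_bounds by linarith
  then show ?thesis
    using assms(4) by (simp add: power2_eq_square flip: mult.assoc)
qed

lemma card_close_divisors:
  fixes \<epsilon> k :: real and N m :: nat
  assumes "\<epsilon> > 0" "N > 0" "k = real N powr (gamma0 - \<epsilon>)" "m > 0" "real m \<le> 3 * real N * k"
    and "finite S" "card S \<ge> 2"
    and "\<And>d. d \<in> S \<Longrightarrow> d dvd m \<and> 2 * real N \<le> real d"
    and "\<And>x y. x \<in> S \<Longrightarrow> y \<in> S \<Longrightarrow> \<bar>real x - real y\<bar> \<le> k / 3"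
  shows "\<epsilon> * real (card S) < 2"
proof -
  define \<beta> where "\<beta> = gamma0 - \<epsilon>"
  define t where "t = card S"
  define h where "h = nat \<lfloor>gamma0 * real t\<rfloor>"
  have t2: "t \<ge> 2" using assms(7) by (simp add: t_def)
  \<comment> \<open>Two distinct integers at distance at most k/3 force k \<ge> 3, which excludes N
    = 1 and \<beta> \<le> 0, since either would give k \<le> 1.\<close>
  obtain x y where "x \<in> S" "y \<in> S" "x \<noteq> y"
    using assms(7) by (metis One_nat_def card_le_Suc0_iff_eq assms(6) not_less_eq_eq numeral_2_eq_2)
  then have "k \<ge> 3"
    using assms(9)[of x y] by linarith
  have N: "real N > 1"
    using \<open>k \<ge> 3\<close> assms(2,3) by (cases "N = 1") auto
  have "\<beta> > 0"
  proof (rule ccontr)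
    assume "\<not> \<beta> > 0"
    then have "real N powr \<beta> \<le> real N powr 0"
      using N by (intro powr_mono) auto
    then show False using \<open>k \<ge> 3\<close> assms(3) N by (simp add: \<beta>_def)
  qed
  have h_floor: "real h \<le> gamma0 * real t" "gamma0 * real t < real h + 1"
    using gamma0_bounds by (auto simp: h_def)
  \<comment> \<open>With t \<ge> 2 the product \<open>gamma0 * t\<close> lies strictly between 1 and
    \<open>t\<close>, so its floor lies between 1 and \<open>t - 1\<close>.\<close>
  have "gamma0 * real t < real t" "1 / 2 * real t < gamma0 * real t"
    using gamma0_bounds t2 by simp_all
  then have h: "h \<ge> 1" "h + 1 \<le> t"
    using h_floor t2 by linarith+
  define a b where "a = h * (h + 1)" and "b = t * (t - 1)"
  \<comment> \<open>This lets the factor \<open>3 ^ b\<close> from the gaps k/3 absorb the factor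
    \<open>3 ^ a\<close> from m \<le> 3Nk.\<close>
  have "a \<le> b"
    using h mult_mono[of h "t - 1" "h + 1" t] by (simp add: a_def b_def mult.commute)
  have "(2 * real N) ^ (2 * h * t) \<le> real m ^ a * (k / 3) ^ b"
    unfolding t_def a_def b_def
    using assms(4,6,8,9) by (intro close_divisors_power_le) auto
  also have "\<dots> \<le> (3 * (real N * k)) ^ a * (k / 3) ^ b"
    using assms(5) \<open>k \<ge> 3\<close> by (intro mult_right_mono power_mono) (auto simp: mult.assoc)
  also have "\<dots> = 3 ^ a / 3 ^ b * ((real N * k) ^ a * k ^ b)"
    by (simp add: power_mult_distrib power_divide)
  also have "\<dots> \<le> 1 * ((real N * k) ^ a * k ^ b)"
    using \<open>a \<le> b\<close> \<open>k \<ge> 3\<close> by (intro mult_right_mono) (auto simp: power_increasing)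
  also have "\<dots> = real N powr ((1 + \<beta>) * real a + \<beta> * real b)"
  proof -
    have "real N * k = real N powr (1 + \<beta>)"
      using N assms(3) by (simp add: \<beta>_def powr_add)
    moreover have "k = real N powr \<beta>"
      using assms(3) by (simp add: \<beta>_def)
    ultimately have "(real N * k) ^ a * k ^ b = (real N powr (1 + \<beta>)) ^ a * (real N powr \<beta>) ^ b"
      by metis
    also have "\<dots> = real N powr ((1 + \<beta>) * real a) * real N powr (\<beta> * real b)"
      using N by (simp add: powr_powr flip: powr_realpow)
    finally show ?thesis
      by (simp add: powr_add)
  qed
  finally have le: "(2 * real N) ^ (2 * h * t) \<le> real N powr ((1 + \<beta>) * real a + \<beta> * real b)" .
  \<comment> \<open>Dropping the factor 2 makes the inequality strict; as N > 1, the exponents can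
    then be compared.\<close>
  have "real N ^ (2 * h * t) < (2 * real N) ^ (2 * h * t)"
    using N h t2 by (intro power_strict_mono) auto
  from less_le_trans[OF this le] have "real N powr real (2 * h * t) < real N powr ((1 + \<beta>) * real a + \<beta> * real b)"
    using N by (subst powr_realpow) auto
  then have "2 * real h * real t < (1 + \<beta>) * real a + \<beta> * real b"
    using N by simp
  then show ?thesis
    unfolding a_def b_def t_def[symmetric]
    using \<open>\<beta> > 0\<close> assms(1) h h_floor
    by (intro exponent_bound[of \<beta> \<epsilon> h t]) (auto simp: \<beta>_def)
qed

text \<open>For N = 1 one has k = 1 whatever \<epsilon> is, and m = 2 has the divisor 2 in [2, 4],
  so no bound C/\<epsilon> holds for all large \<epsilon>. Hence the restriction on \<epsilon> in
  that case.\<close>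

theorem theorem1p6:
  "\<exists>C::real. C > 0 \<and>
     (\<forall>(\<epsilon>::real) (N::nat) (k::real) (m::nat).
        \<epsilon> > 0 \<longrightarrow> N > 0 \<longrightarrow> (N = 1 \<longrightarrow> \<epsilon> \<le> gamma0) \<longrightarrow>
        k = real N powr (gamma0 - \<epsilon>) \<longrightarrow>
        m > 0 \<longrightarrow> real m \<le> 3 * real N * k \<longrightarrow>
        real (tau m (2 * real N) (2 * real N + 2 * k)) \<le> C * inverse \<epsilon>)"
\<comment> \<open>The constant is 7 * 2: seven pieces with at most 2/\<epsilon> divisors
  each.\<close>
proof (intro exI[of _ 14] conjI allI impI)
  fix \<epsilon> k :: real and N m :: nat
  assume eps: "\<epsilon> > 0" and N: "N > 0" "N = 1 \<longrightarrow> \<epsilon> \<le> gamma0"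
    and k: "k = real N powr (gamma0 - \<epsilon>)" and m: "m > 0" "real m \<le> 3 * real N * k"
  define T where "T = {d::nat. d dvd m \<and> 2 * real N \<le> real d \<and> real d \<le> 2 * real N + 2 * k}"
  define I where "I i = {d \<in> T. \<lfloor>(real d - 2 * real N) / (k / 3)\<rfloor> = int i}" for i :: nat
  have k_pos: "k > 0" using k N by simp
  have fin: "finite T"
    using m(1) by (auto simp: T_def intro: finite_subset[OF _ finite_divisors_nat[of m]])
  have tau: "tau m (2 * real N) (2 * real N + 2 * k) = card T"
    by (simp add: tau_def T_def)
  show "real (tau m (2 * real N) (2 * real N + 2 * k)) \<le> 14 * inverse \<epsilon>"
  proof (cases "T = {}")
    case True
    then show ?thesis using eps by (simp add: tau)
  next
    case False
    then obtain d where "d dvd m" "2 * real N \<le> real d" by (auto simp: T_def)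
    then have "2 * real N \<le> 3 * real N * k"
      using m dvd_imp_le[of d m] by linarith
    then have k23: "k \<ge> 2 / 3" using N by simp
    \<comment> \<open>Needed for pieces with at most one divisor, where 1 \<le> 2/\<epsilon> must
      hold. For N \<ge> 2, a larger \<epsilon> would make k at most 1/N, against k \<ge>
      2/3.\<close>
    have eps2: "\<epsilon> \<le> 2"
    proof (rule ccontr)
      assume *: "\<not> \<epsilon> \<le> 2"
      then have "N \<ge> 2" using N gamma0_bounds by (cases "N = 1") auto
      then have "k \<le> real N powr (- 1)"
        using * gamma0_bounds unfolding k by (intro powr_mono) auto
      also have "\<dots> \<le> 1 / 2"
        using \<open>N \<ge> 2\<close> by (simp add: powr_minus divide_simps)
      finally show False using k23 by simp
    qed
    have card_I: "real (card (I i)) \<le> 2 * inverse \<epsilon>" for i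
    proof (cases "card (I i) \<ge> 2")
      case True
      have "\<epsilon> * real (card (I i)) < 2"
      proof (rule card_close_divisors[OF eps N(1) k m _ True])
        fix x y assume "x \<in> I i" "y \<in> I i"
        then have "\<bar>(real x - 2 * real N) / (k / 3) - (real y - 2 * real N) / (k / 3)\<bar> \<le> 1"
          unfolding I_def by (simp only: mem_Collect_eq) linarith
        then have "\<bar>(real x - real y) / (k / 3)\<bar> \<le> 1"
          by (simp flip: diff_divide_distrib)
        then show "\<bar>real x - real y\<bar> \<le> k / 3"
          using k_pos by (simp only: abs_le_iff) (auto simp: field_simps)
      qed (use fin in \<open>auto simp: I_def T_def intro: finite_subset[of _ T]\<close>)
      then show ?thesis using eps by (simp add: field_simps)
    next
      case False
      then have "real (card (I i)) \<le> 1" by simp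
      also have "1 \<le> 2 * inverse \<epsilon>" using eps eps2 by (simp add: field_simps)
      finally show ?thesis .
    qed
    have "T \<subseteq> (\<Union>i\<in>{..6}. I i)"
    proof
      fix d assume d: "d \<in> T"
      define q where "q = (real d - 2 * real N) / (k / 3)"
      \<comment> \<open>The value 6 occurs when d = 2N + 2k, so the half-open pieces need the
        seventh index.\<close>
      have "0 \<le> q" "q \<le> 6"
        using d k_pos by (auto simp: T_def q_def field_simps)
      then have "\<lfloor>q\<rfloor> = int (nat \<lfloor>q\<rfloor>)" "nat \<lfloor>q\<rfloor> \<le> 6"
        by linarith+
      then show "d \<in> (\<Union>i\<in>{..6}. I i)"
        using d unfolding I_def q_def by blast
    qed
    then have "card T \<le> card (\<Union>i\<in>{..6}. I i)"
      using fin by (intro card_mono) (auto simp: I_def)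
    also have "\<dots> \<le> (\<Sum>i\<le>6. card (I i))"
      by (rule card_UN_le) simp
    finally have "real (card T) \<le> (\<Sum>i\<le>6. real (card (I i)))"
      by (metis of_nat_le_iff of_nat_sum)
    also have "\<dots> \<le> (\<Sum>i\<le>(6::nat). 2 * inverse \<epsilon>)"
      by (intro sum_mono card_I)
    finally show ?thesis by (simp add: tau)
  qed
qed simp

end
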